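(* For all terms $s,t$ over the signature $\Sigma_{\mathrm{BCCSP}_D^c}$, if $s=t$ is derivable from the axiom system $E_{\mathrm{BCCSP}_D^c}$, then $s$ and $t$ are strongly bisimilar with respect to $\mathrm{BCCSP}_D^c$.
   Context: The data signature $\Sigma_D$ is a finite set of constants, and $L$ is a set of action labels. Closed process terms of $\mathrm{BCCSP}_D^c$ are generated by $t ::= \mathbf{0} \mid l.t\ (l\in L) \mid \mathit{check}(d,t) \mid \mathit{update}(d,t) \mid t+t$ with $d$ a data constant (open terms additionally allow process variables and data variables in data positions). The transition system has labels $(d,l,d')$ with $d,d'\in\Sigma_D$, $l\in L$, and is given by the rules (for all data values $x_D,x'_D,y_D$): $l.x_P\xrightarrow{(x_D,l,x_D)}x_P$; if $x_P\xrightarrow{(x_D,l,x'_D)}x'_P$ then $\mathit{check}(x_D,x_P)\xrightarrow{(x_D,l,x'_D)}x'_P$; if $x_P\xrightarrow{(x_D,l,x'_D)}x'_P$ then $\mathit{update}(y_D,x_P)\xrightarrow{(x_D,l,y_D)}x'_P$; if $x_P\xrightarrow{(x_D,l,x'_D)}x'_P$ then $x_P+y_P\xrightarrow{(x_D,l,x'_D)}x'_P$ and $y_P+x_P\xrightarrow{(x_D,l,x'_D)}x'_P$. Strong bisimilarity: a symmetric relation $R$ on closed process terms such that $(p,q)\in R$ and $p\xrightarrow{(d,l,d')}p'$ imply $q\xrightarrow{(d,l,d')}q'$ for some $q'$ with $(p',q')\in R$; $p,q$ are strongly bisimilar if related by such an $R$. For open terms, strong bisimilarity means strong bisimilarity of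 all closed instances. $E_{\mathrm{BCCSP}_D^c}$ consists of: $x_P+y_P=y_P+x_P$; $x_P+(y_P+z_P)=(x_P+y_P)+z_P$; $x_P+x_P=x_P$; $x_P+\mathbf{0}=x_P$; $\mathit{check}(x_D,x_P+y_P)=\mathit{check}(x_D,x_P)+\mathit{check}(x_D,y_P)$; $\mathit{update}(x_D,x_P+y_P)=\mathit{update}(x_D,x_P)+\mathit{update}(x_D,y_P)$; $\mathit{check}(x_D,\mathit{update}(y_D,x_P))=\mathit{update}(y_D,\mathit{check}(x_D,x_P))$; $\mathit{update}(x_D,\mathit{update}(y_D,x_P))=\mathit{update}(x_D,x_P)$; $\mathit{check}(d,\mathit{check}(d,x_P))=\mathit{check}(d,x_P)$ for all $d\in\Sigma_D$; $\mathit{check}(d,\mathit{check}(d',x_P))=\mathbf{0}$ for all $d\neq d'$ in $\Sigma_D$; $l.x_P=\sum_{d\in\Sigma_D}\mathit{update}(d,\mathit{check}(d,l.x_P))$ for all $l\in L$. Derivability means membership in the smallest congruence containing all substitution instances of these equations. *)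

theory Defs
  imports Main
begin

text \<open>The data signature \<open>D\<close> and the set of action labels \<open>L\<close> are explicit sets rather than
  types, so that neither is forced to be nonempty. Process variables and data variables form two
  separate countably infinite families, both indexed by \<open>nat\<close>.\<close>

datatype (dterm_consts: 'd) dterm = DVar nat | DConst 'd

datatype (data_consts: 'd, labels: 'l) pterm =
    PVar nat
  | Zero  ("\<zero>")
  | Act 'l "('d, 'l) pterm"
  | Check "'d dterm" "('d, 'l) pterm"
  | Update "'d dterm" "('d, 'l) pterm"
  | Plus "('d, 'l) pterm" "('d, 'l) pterm"  (infixl "\<oplus>" 65)

definition dterms :: "'d set \<Rightarrow> 'd dterm set" where
  "dterms D = {e. dterm_consts e \<subseteq> D}"

definition pterms :: "'d set \<Rightarrow> 'l set \<Rightarrow> ('d, 'l) pterm set" where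
  "pterms D L = {t. data_consts t \<subseteq> D \<and> labels t \<subseteq> L}"

fun dclosed :: "'d dterm \<Rightarrow> bool" where
  "dclosed (DVar _) = False"
| "dclosed (DConst _) = True"

fun pclosed :: "('d, 'l) pterm \<Rightarrow> bool" where
  "pclosed (PVar _) = False"
| "pclosed \<zero> = True"
| "pclosed (Act _ p) = pclosed p"
| "pclosed (Check e p) = (dclosed e \<and> pclosed p)"
| "pclosed (Update e p) = (dclosed e \<and> pclosed p)"
| "pclosed (p \<oplus> q) = (pclosed p \<and> pclosed q)"

definition closed_pterms :: "'d set \<Rightarrow> 'l set \<Rightarrow> ('d, 'l) pterm set" where
  "closed_pterms D L = {t \<in> pterms D L. pclosed t}"

fun dsubst :: "(nat \<Rightarrow> 'd dterm) \<Rightarrow> 'd dterm \<Rightarrow> 'd dterm" where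
  "dsubst \<delta> (DVar n) = \<delta> n"
| "dsubst \<delta> (DConst d) = DConst d"

fun psubst :: "(nat \<Rightarrow> 'd dterm) \<Rightarrow> (nat \<Rightarrow> ('d, 'l) pterm) \<Rightarrow> ('d, 'l) pterm \<Rightarrow> ('d, 'l) pterm" where
  "psubst \<delta> \<sigma> (PVar n) = \<sigma> n"
| "psubst \<delta> \<sigma> \<zero> = \<zero>"
| "psubst \<delta> \<sigma> (Act l p) = Act l (psubst \<delta> \<sigma> p)"
| "psubst \<delta> \<sigma> (Check e p) = Check (dsubst \<delta> e) (psubst \<delta> \<sigma> p)"
| "psubst \<delta> \<sigma> (Update e p) = Update (dsubst \<delta> e) (psubst \<delta> \<sigma> p)"
| "psubst \<delta> \<sigma> (p \<oplus> q) = psubst \<delta> \<sigma> p \<oplus> psubst \<delta> \<sigma> q"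

text \<open>The relation is used only on closed terms over \<open>D\<close> and \<open>L\<close>. There the side condition of
  the axiom for \<open>Act\<close> suffices: all other data values and labels of a derivable transition occur in
  its source, and its target is again a closed term over \<open>D\<close> and \<open>L\<close>.\<close>

inductive step :: "'d set \<Rightarrow> ('d, 'l) pterm \<Rightarrow> 'd \<times> 'l \<times> 'd \<Rightarrow> ('d, 'l) pterm \<Rightarrow> bool"
  for D :: "'d set" where
  act: "d \<in> D \<Longrightarrow> step D (Act l p) (d, l, d) p"
| check: "step D p (d, l, d') p' \<Longrightarrow> step D (Check (DConst d) p) (d, l, d') p'"
| update: "step D p (d, l, d') p' \<Longrightarrow> step D (Update (DConst e) p) (d, l, e) p'"
| plus_left: "step D p (d, l, d') p' \<Longrightarrow> step D (p \<oplus> q) (d, l, d') p'"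
| plus_right: "step D p (d, l, d') p' \<Longrightarrow> step D (q \<oplus> p) (d, l, d') p'"

definition bisimulation :: "'d set \<Rightarrow> 'l set \<Rightarrow> ('d, 'l) pterm rel \<Rightarrow> bool" where
  "bisimulation D L R \<longleftrightarrow>
     R \<subseteq> closed_pterms D L \<times> closed_pterms D L \<and> sym R \<and>
     (\<forall>p q d l d' p'. (p, q) \<in> R \<and> step D p (d, l, d') p' \<longrightarrow>
        (\<exists>q'. step D q (d, l, d') q' \<and> (p', q') \<in> R))"

definition closed_bisimilar :: "'d set \<Rightarrow> 'l set \<Rightarrow> ('d, 'l) pterm \<Rightarrow> ('d, 'l) pterm \<Rightarrow> bool" where
  "closed_bisimilar D L p q \<longleftrightarrow> (\<exists>R. bisimulation D L R \<and> (p, q) \<in> R)"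

text \<open>Only the instances are required to be closed, not the whole substitution: if \<open>D\<close> is empty,
  no closed data substitution exists, but a pair of closed terms still is its own closed instance.\<close>

definition bisimilar :: "'d set \<Rightarrow> 'l set \<Rightarrow> ('d, 'l) pterm \<Rightarrow> ('d, 'l) pterm \<Rightarrow> bool" where
  "bisimilar D L s t \<longleftrightarrow>
     (\<forall>\<delta> \<sigma>. psubst \<delta> \<sigma> s \<in> closed_pterms D L \<and> psubst \<delta> \<sigma> t \<in> closed_pterms D L \<longrightarrow>
        closed_bisimilar D L (psubst \<delta> \<sigma> s) (psubst \<delta> \<sigma> t))"

fun psum :: "('d, 'l) pterm list \<Rightarrow> ('d, 'l) pterm" where
  "psum [] = \<zero>"
| "psum [p] = p"
| "psum (p # q # ps) = p \<oplus> psum (q # ps)"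

text \<open>In \<open>expand\<close> the sum over the finite set \<open>D\<close> is taken along every enumeration \<open>ds\<close> of \<open>D\<close>
  without repetition.\<close>

inductive_set axioms_BCCSP :: "'d set \<Rightarrow> 'l set \<Rightarrow> ('d, 'l) pterm rel"
  for D :: "'d set" and L :: "'l set" where
  plus_comm: "(PVar 0 \<oplus> PVar 1, PVar 1 \<oplus> PVar 0) \<in> axioms_BCCSP D L"
| plus_assoc: "(PVar 0 \<oplus> (PVar 1 \<oplus> PVar 2), (PVar 0 \<oplus> PVar 1) \<oplus> PVar 2) \<in> axioms_BCCSP D L"
| plus_idem: "(PVar 0 \<oplus> PVar 0, PVar 0) \<in> axioms_BCCSP D L"
| plus_zero: "(PVar 0 \<oplus> \<zero>, PVar 0) \<in> axioms_BCCSP D L"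
| check_plus: "(Check (DVar 0) (PVar 0 \<oplus> PVar 1),
    Check (DVar 0) (PVar 0) \<oplus> Check (DVar 0) (PVar 1)) \<in> axioms_BCCSP D L"
| update_plus: "(Update (DVar 0) (PVar 0 \<oplus> PVar 1),
    Update (DVar 0) (PVar 0) \<oplus> Update (DVar 0) (PVar 1)) \<in> axioms_BCCSP D L"
| check_update: "(Check (DVar 0) (Update (DVar 1) (PVar 0)),
    Update (DVar 1) (Check (DVar 0) (PVar 0))) \<in> axioms_BCCSP D L"
| update_update: "(Update (DVar 0) (Update (DVar 1) (PVar 0)),
    Update (DVar 0) (PVar 0)) \<in> axioms_BCCSP D L"
| check_same: "d \<in> D \<Longrightarrow>
    (Check (DConst d) (Check (DConst d) (PVar 0)), Check (DConst d) (PVar 0)) \<in> axioms_BCCSP D L"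
| check_diff: "d \<in> D \<Longrightarrow> d' \<in> D \<Longrightarrow> d \<noteq> d' \<Longrightarrow>
    (Check (DConst d) (Check (DConst d') (PVar 0)), \<zero>) \<in> axioms_BCCSP D L"
| expand: "l \<in> L \<Longrightarrow> distinct ds \<Longrightarrow> set ds = D \<Longrightarrow>
    (Act l (PVar 0),
     psum (map (\<lambda>d. Update (DConst d) (Check (DConst d) (Act l (PVar 0)))) ds)) \<in> axioms_BCCSP D L"

text \<open>There are no equations between data terms, so the congruence is the identity on them.\<close>

inductive derivable :: "'d set \<Rightarrow> 'l set \<Rightarrow> ('d, 'l) pterm \<Rightarrow> ('d, 'l) pterm \<Rightarrow> bool"
  for D :: "'d set" and L :: "'l set" where
  inst: "(s, t) \<in> axioms_BCCSP D L \<Longrightarrow> range \<delta> \<subseteq> dterms D \<Longrightarrow> range \<sigma> \<subseteq> pterms D L \<Longrightarrow>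
    derivable D L (psubst \<delta> \<sigma> s) (psubst \<delta> \<sigma> t)"
| refl: "t \<in> pterms D L \<Longrightarrow> derivable D L t t"
| sym: "derivable D L s t \<Longrightarrow> derivable D L t s"
| trans: "derivable D L s t \<Longrightarrow> derivable D L t u \<Longrightarrow> derivable D L s u"
| cong_act: "l \<in> L \<Longrightarrow> derivable D L s t \<Longrightarrow> derivable D L (Act l s) (Act l t)"
| cong_check: "e \<in> dterms D \<Longrightarrow> derivable D L s t \<Longrightarrow> derivable D L (Check e s) (Check e t)"
| cong_update: "e \<in> dterms D \<Longrightarrow> derivable D L s t \<Longrightarrow> derivable D L (Update e s) (Update e t)"
| cong_plus: "derivable D L s t \<Longrightarrow> derivable D L s' t' \<Longrightarrow> derivable D L (s \<oplus> s') (t \<oplus> t')"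

end

theory Submission
  imports Defs
begin

text \<open>Call two terms, open or closed, \<open>step_equiv\<close> if they match each other's transitions
  coinductively. Both sides of every axiom have exactly the same transitions as soon as their data
  variables are replaced by constants, and every operator exposes at most one transition of its
  arguments, so neither axioms nor congruence rules need a genuine coinduction. On closed terms
  the relation is a bisimulation.

  An intermediate term in a transitivity step may contain variables absent from both ends, which
  the given substitution may leave open. For process variables this does no harm. For data variables it
  does: \<open>update(d, update(e, x)) = update(d, x)\<close> fails when \<open>e\<close> is a variable, which blocks all
  transitions. Such variables are therefore mapped to an arbitrary constant, which need not
  belong to \<open>D\<close>, so \<open>D = \<emptyset>\<close> is no exception.\<close>

text \<open>Inversion stated as equivalences lets the simplifier compute the transitions of a term
  from its outermost operator. A \<open>Check\<close> or \<open>Update\<close> on a data variable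
  has none.\<close>

lemma step_simps [simp]:
  "step D (PVar n) (d, l, d') p' \<longleftrightarrow> False"
  "step D \<zero> (d, l, d') p' \<longleftrightarrow> False"
  "step D (Act k p) (d, l, d') p' \<longleftrightarrow> d \<in> D \<and> k = l \<and> d' = d \<and> p' = p"
  "step D (Check e p) (d, l, d') p' \<longleftrightarrow> e = DConst d \<and> step D p (d, l, d') p'"
  "step D (Update e p) (d, l, d') p' \<longleftrightarrow> e = DConst d' \<and> (\<exists>c. step D p (d, l, c) p')"
  "step D (p \<oplus> q) (d, l, d') p' \<longleftrightarrow> step D p (d, l, d') p' \<or> step D q (d, l, d') p'"
  by (subst step.simps; auto)+

lemma step_psum:
  "step D (psum ps) (d, l, d') p' \<longleftrightarrow> (\<exists>p\<in>set ps. step D p (d, l, d') p')"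
  by (induction ps rule: psum.induct) auto

lemma psubst_psum: "psubst \<delta> \<sigma> (psum ps) = psum (map (psubst \<delta> \<sigma>) ps)"
  by (induction ps rule: psum.induct) auto

text \<open>The target is a subterm of the source. The value \<open>d'\<close> is generalized
  because \<open>Update\<close> changes it.\<close>

lemma step_closed_pterms:
  "step D p (d, l, d') p' \<Longrightarrow> p \<in> closed_pterms D L \<Longrightarrow> p' \<in> closed_pterms D L"
  by (induction p "(d, l, d')" p' arbitrary: d' rule: step.induct)
    (auto simp: closed_pterms_def pterms_def)

coinductive step_equiv :: "'d set \<Rightarrow> ('d, 'l) pterm \<Rightarrow> ('d, 'l) pterm \<Rightarrow> bool"
  for D :: "'d set" where
  "(\<And>d l d' p'. step D p (d, l, d') p' \<Longrightarrow> \<exists>q'. step D q (d, l, d') q' \<and> step_equiv D p' q') \<Longrightarrow>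
   (\<And>d l d' q'. step D q (d, l, d') q' \<Longrightarrow> \<exists>p'. step D p (d, l, d') p' \<and> step_equiv D p' q') \<Longrightarrow>
   step_equiv D p q"

lemma step_equiv_forth:
  "step_equiv D p q \<Longrightarrow> step D p (d, l, d') p' \<Longrightarrow> \<exists>q'. step D q (d, l, d') q' \<and> step_equiv D p' q'"
  by (erule step_equiv.cases) blast

lemma step_equiv_back:
  "step_equiv D p q \<Longrightarrow> step D q (d, l, d') q' \<Longrightarrow> \<exists>p'. step D p (d, l, d') p' \<and> step_equiv D p' q'"
  by (erule step_equiv.cases) blast

lemma step_equiv_refl: "step_equiv D p p"
  by (coinduction arbitrary: p) auto

lemma step_equiv_sym: "step_equiv D p q \<Longrightarrow> step_equiv D q p"
proof (coinduction arbitrary: p q)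
  case step_equiv
  then show ?case
    by (meson step_equiv_forth step_equiv_back)
qed

text \<open>Coinduction on the composition of \<open>step_equiv\<close> with itself: each transition
  passes through the middle term, whose own target links the two ends again.\<close>

lemma step_equiv_trans: "step_equiv D p q \<Longrightarrow> step_equiv D q r \<Longrightarrow> step_equiv D p r"
proof (coinduction arbitrary: p q r)
  case (step_equiv p q r)
  note pq = step_equiv(1) and qr = step_equiv(2)
  have "\<exists>r'. step D r (d, l, d') r' \<and> (\<exists>q'. step_equiv D p' q' \<and> step_equiv D q' r')"
    if p': "step D p (d, l, d') p'" for d l d' p'
  proof -
    obtain q' where q': "step D q (d, l, d') q'" "step_equiv D p' q'"
      using step_equiv_forth[OF pq p'] by blast
    with step_equiv_forth[OF qr q'(1)] show ?thesis by blast
  qed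
  moreover have "\<exists>p'. step D p (d, l, d') p' \<and> (\<exists>q'. step_equiv D p' q' \<and> step_equiv D q' r')"
    if r': "step D r (d, l, d') r'" for d l d' r'
  proof -
    obtain q' where q': "step D q (d, l, d') q'" "step_equiv D q' r'"
      using step_equiv_back[OF qr r'] by blast
    with step_equiv_back[OF pq q'(1)] show ?thesis by blast
  qed
  ultimately show ?case by simp meson
qed

lemma step_equiv_if_same_steps:
  "(\<And>d l d' p'. step D p (d, l, d') p' \<longleftrightarrow> step D q (d, l, d') p') \<Longrightarrow> step_equiv D p q"
  by (rule step_equiv.intros) (auto intro: step_equiv_refl)

lemma step_equiv_Act: "step_equiv D p q \<Longrightarrow> step_equiv D (Act l p) (Act l q)"
  by (rule step_equiv.intros) auto

lemma step_equiv_Check: "step_equiv D p q \<Longrightarrow> step_equiv D (Check e p) (Check e q)"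
  by (rule step_equiv.intros) (auto dest: step_equiv_forth step_equiv_back)

lemma step_equiv_Update: "step_equiv D p q \<Longrightarrow> step_equiv D (Update e p) (Update e q)"
  by (rule step_equiv.intros; simp) (meson step_equiv_forth step_equiv_back)+

lemma step_equiv_Plus:
  "step_equiv D p q \<Longrightarrow> step_equiv D p' q' \<Longrightarrow> step_equiv D (p \<oplus> p') (q \<oplus> q')"
  by (rule step_equiv.intros) (auto dest: step_equiv_forth step_equiv_back)

lemma closed_bisimilar_if_step_equiv:
  assumes "step_equiv D p q" "p \<in> closed_pterms D L" "q \<in> closed_pterms D L"
  shows "closed_bisimilar D L p q"
proof -
  \<comment> \<open>\<open>step_equiv\<close> also relates open terms, so it is cut down to closed
    ones.\<close>
  let ?R = "{(p, q). p \<in> closed_pterms D L \<and> q \<in> closed_pterms D L \<and> step_equiv D p q}"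
  have "bisimulation D L ?R"
    unfolding bisimulation_def sym_def
  proof (intro conjI allI impI; (elim conjE)?)
    fix p q d l d' p'
    assume "(p, q) \<in> ?R" and p': "step D p (d, l, d') p'"
    then have closed: "p \<in> closed_pterms D L" "q \<in> closed_pterms D L" and "step_equiv D p q"
      by simp_all
    then obtain q' where q': "step D q (d, l, d') q'" "step_equiv D p' q'"
      using step_equiv_forth[OF _ p'] by blast
    with closed p' show "\<exists>q'. step D q (d, l, d') q' \<and> (p', q') \<in> ?R"
      using step_closed_pterms by fast
  qed (auto simp: step_equiv_sym intro: symI)
  with assms show ?thesis
    unfolding closed_bisimilar_def by blast
qed

lemma dclosed_iff: "dclosed e \<longleftrightarrow> (\<exists>d. e = DConst d)"
  by (cases e) auto

lemma dclosed_dsubst: "(\<And>n. dclosed (\<delta> n)) \<Longrightarrow> dclosed (dsubst \<delta> e)"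
  by (cases e) auto

lemma dsubst_dsubst: "dsubst \<delta> (dsubst \<epsilon> e) = dsubst (\<lambda>n. dsubst \<delta> (\<epsilon> n)) e"
  by (cases e) auto

lemma psubst_psubst:
  "psubst \<delta> \<sigma> (psubst \<epsilon> \<tau> t) = psubst (\<lambda>n. dsubst \<delta> (\<epsilon> n)) (\<lambda>n. psubst \<delta> \<sigma> (\<tau> n)) t"
  by (induction t) (auto simp: dsubst_dsubst)

lemma dsubst_cong_closed:
  assumes "dclosed (dsubst \<delta> e)" "\<And>n. dclosed (\<delta> n) \<Longrightarrow> \<delta>' n = \<delta> n"
  shows "dsubst \<delta>' e = dsubst \<delta> e"
  using assms by (cases e) auto

text \<open>A data variable occurring in \<open>t\<close> must have a closed value, or the instance
  would be open; hence \<open>\<delta>'\<close> agrees with \<open>\<delta>\<close> wherever it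
  matters.\<close>

lemma psubst_cong_closed:
  assumes "pclosed (psubst \<delta> \<sigma> t)" "\<And>n. dclosed (\<delta> n) \<Longrightarrow> \<delta>' n = \<delta> n"
  shows "psubst \<delta>' \<sigma> t = psubst \<delta> \<sigma> t"
  using assms by (induction t) (auto intro: dsubst_cong_closed)

lemma axiom_step_equiv:
  assumes "(s, t) \<in> axioms_BCCSP D L" "\<And>n. dclosed (\<delta> n)"
  shows "step_equiv D (psubst \<delta> \<sigma> s) (psubst \<delta> \<sigma> t)"
proof -
  obtain v where "\<And>n. \<delta> n = DConst (v n)"
    using assms(2) unfolding dclosed_iff by metis
  \<comment> \<open>In the case \<open>expand\<close>, the summand for \<open>d\<close> contributes
    exactly the transition labelled \<open>(d, l, d)\<close>, and \<open>ds\<close> runs through all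
    of \<open>D\<close>, as does the rule for \<open>Act\<close>.\<close>
  with assms(1) show ?thesis
    by (cases rule: axioms_BCCSP.cases)
      (auto intro!: step_equiv_if_same_steps simp: psubst_psum step_psum)
qed

lemma derivable_step_equiv:
  assumes "derivable D L s t" "\<And>n. dclosed (\<delta> n)"
  shows "step_equiv D (psubst \<delta> \<sigma> s) (psubst \<delta> \<sigma> t)"
  using assms(1)
proof induction
  \<comment> \<open>An instance of an axiom instance is again an axiom instance, under the composed
    substitution; its data part is closed because \<open>\<delta>\<close> is.\<close>
  case (inst s t \<epsilon> \<tau>)
  then show ?case
    unfolding psubst_psubst by (intro axiom_step_equiv dclosed_dsubst assms(2))
qed (auto intro: step_equiv_refl step_equiv_sym step_equiv_trans step_equiv_Act step_equiv_Check
    step_equiv_Update step_equiv_Plus)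

theorem mainTheorem2:
  fixes D :: "'d set" and L :: "'l set" and s t :: "('d, 'l) pterm"
  assumes "finite D"
    and "s \<in> pterms D L" and "t \<in> pterms D L"
    and "derivable D L s t"
  shows "bisimilar D L s t"
  unfolding bisimilar_def
proof (intro allI impI, elim conjE)
  fix \<delta> \<sigma>
  assume closed: "psubst \<delta> \<sigma> s \<in> closed_pterms D L" "psubst \<delta> \<sigma> t \<in> closed_pterms D L"
  define \<delta>' where "\<delta>' n = (if dclosed (\<delta> n) then \<delta> n else DConst undefined)" for n
  have "step_equiv D (psubst \<delta>' \<sigma> s) (psubst \<delta>' \<sigma> t)"
    by (rule derivable_step_equiv[OF assms(4)]) (simp add: \<delta>'_def)
  moreover have "psubst \<delta>' \<sigma> s = psubst \<delta> \<sigma> s" "psubst \<delta>' \<sigma> t = psubst \<delta> \<sigma> t"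
    using closed by (auto simp: closed_pterms_def \<delta>'_def intro!: psubst_cong_closed)
  ultimately show "closed_bisimilar D L (psubst \<delta> \<sigma> s) (psubst \<delta> \<sigma> t)"
    using closed by (auto intro: closed_bisimilar_if_step_equiv)
qed

end
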